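(* Let $\pi : M \rightarrow B$ be the Boothby-Wang fibration from a regular closed contact metric manifold $(M,\eta,\tilde g,\phi)$ to a symplectic metric manifold $(B,\omega,g,J)$. Suppose $\pi$ is a conformal submersion of the underlying Riemannian manifolds $(M,\tilde g)$ and $(B,g)$. Then $\pi$ is a Riemannian submersion and $(M,\eta,\tilde g,\phi)$ is a $K$-contact manifold.
   Context: A contact form on a manifold $M$ of dimension $2n+1$ is a 1-form $\eta$ with $\eta\wedge(d\eta)^n\neq 0$ everywhere; its Reeb vector field $\xi$ is determined by $\eta(\xi)=1$ and $d\eta(\xi,\cdot)=0$. A contact metric manifold $(M,\eta,\tilde g,\phi)$ consists of a contact form $\eta$, a Riemannian metric $\tilde g$ and a $(1,1)$-tensor field $\phi$ with $\eta=i_\xi\tilde g$, $\phi^2=-I+\eta\otimes\xi$ and $d\eta(X,Y)=\tilde g(X,\phi Y)$. It is $K$-contact if $\xi$ is Killing, i.e. $\mathcal L_\xi\tilde g=0$. It is regular if $\xi$ is a regular vector field (around each point there is a flow box pierced at most once by any integral curve). A symplectic metric manifold $(B,\omega,g,J)$ consists of a symplectic form $\omega$, a Riemannian metric $g$ and an almost complex structure $J$ with $g(X,JY)=\omega(X,Y)$. Boothby-Wang fibration: for $M$ closed and regular, $\eta$ is taken to be the contact form whose Reeb flow generates a free $\mathbb S^1$-action; $\pi:M\to B$ is the resulting principal $\mathbb S^1$-bundle whose fibers are the orbits of $\xi$, and $\omega$ is the symplectic form on $B$ with $\pi^*\omega=d\eta$. $\pi$ is a conformal submersion if $d\pi$ preserves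 angles when restricted to the contact distribution $\mathrm{Ker}(\eta)$, i.e. there is a smooth function $f$ on $M$ with $\tilde g(V,W)=e^{2f}g(d\pi V,d\pi W)$ for all $V,W\in\Gamma(\mathrm{Ker}(\eta))$; it is a Riemannian submersion if $d\pi$ restricted to $\mathrm{Ker}(\eta)$ is an isometry. *)

theory Defs
  imports "HOL-Analysis.Analysis" "HOL-Combinatorics.Permutations"
begin

section \<open>Smooth maps and manifolds\<close>

text \<open>
  For an open set \<open>S\<close> of a Euclidean space: all iterated directional derivatives up to order
  \<open>k\<close> exist and are continuous.
\<close>

primrec Ck_on :: "nat \<Rightarrow> 'm::euclidean_space set \<Rightarrow> ('m \<Rightarrow> 'n::real_normed_vector) \<Rightarrow> bool" where
  "Ck_on 0 S f \<longleftrightarrow> continuous_on S f"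
| "Ck_on (Suc k) S f \<longleftrightarrow>
     (\<forall>y\<in>S. f differentiable (at y)) \<and> (\<forall>v. Ck_on k S (\<lambda>y. frechet_derivative f (at y) v))"

definition smooth_on :: "'m::euclidean_space set \<Rightarrow> ('m \<Rightarrow> 'n::real_normed_vector) \<Rightarrow> bool" where
  "smooth_on S f \<longleftrightarrow> (\<forall>k. Ck_on k S f)"

text \<open>
  A chart is a pair \<open>(U, x)\<close> of a domain and a coordinate map; outside \<open>U\<close> the values of \<open>x\<close> are
  irrelevant.
\<close>

type_synonym ('a, 'm) chart = "'a set \<times> ('a \<Rightarrow> 'm)"

definition chart_inv :: "('a, 'm) chart \<Rightarrow> 'm \<Rightarrow> 'a" where
  "chart_inv c = inv_into (fst c) (snd c)"

definition is_chart :: "('a::topological_space, 'm::euclidean_space) chart \<Rightarrow> bool" where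
  "is_chart c \<longleftrightarrow> open (fst c) \<and> open (snd c ` fst c) \<and>
     homeomorphism (fst c) (snd c ` fst c) (snd c) (chart_inv c)"

text \<open>
  Charts map onto open subsets of the model space, so manifolds have no boundary.  A manifold is a
  Hausdorff second countable type together with a (not necessarily maximal) smooth atlas covering it.
\<close>

definition smooth_atlas :: "('a::{t2_space, second_countable_topology}, 'm::euclidean_space) chart set \<Rightarrow> bool" where
  "smooth_atlas A \<longleftrightarrow> (\<forall>c\<in>A. is_chart c) \<and> (\<Union>c\<in>A. fst c) = UNIV \<and>
     (\<forall>c\<in>A. \<forall>d\<in>A. smooth_on (snd c ` (fst c \<inter> fst d)) (\<lambda>y. snd d (chart_inv c y)))"

definition closed_manifold :: "('a::{t2_space, second_countable_topology}, 'm::euclidean_space) chart set \<Rightarrow> bool" where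
  "closed_manifold A \<longleftrightarrow> smooth_atlas A \<and> compact (UNIV :: 'a set)"

definition eucl_atlas :: "('m::euclidean_space, 'm) chart set" where
  "eucl_atlas = {(UNIV, \<lambda>y. y)}"

definition prod_atlas :: "('a, 'm) chart set \<Rightarrow> ('b, 'n) chart set \<Rightarrow> ('a \<times> 'b, 'm \<times> 'n) chart set" where
  "prod_atlas A B = {(fst c \<times> fst d, map_prod (snd c) (snd d)) | c d. c \<in> A \<and> d \<in> B}"

text \<open>Smoothness of a map between manifolds on an open subset \<open>S\<close> of the source.\<close>

definition smooth_map_on ::
  "('a::topological_space, 'm::euclidean_space) chart set \<Rightarrow>
   ('b::topological_space, 'n::euclidean_space) chart set \<Rightarrow> 'a set \<Rightarrow> ('a \<Rightarrow> 'b) \<Rightarrow> bool" where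
  "smooth_map_on A B S f \<longleftrightarrow> continuous_on S f \<and>
     (\<forall>c\<in>A. \<forall>d\<in>B. smooth_on (snd c ` (S \<inter> fst c \<inter> f -` fst d)) (\<lambda>y. snd d (f (chart_inv c y))))"

abbreviation smooth_map ::
  "('a::topological_space, 'm::euclidean_space) chart set \<Rightarrow>
   ('b::topological_space, 'n::euclidean_space) chart set \<Rightarrow> ('a \<Rightarrow> 'b) \<Rightarrow> bool" where
  "smooth_map A B f \<equiv> smooth_map_on A B UNIV f"

section \<open>Tensor fields\<close>

text \<open>
  A tangent vector at a point \<open>p\<close> is given by its component vector \<open>v :: 'm\<close> in a chart around \<open>p\<close>;
  component vectors in two charts correspond under the derivative of the coordinate change.
  A tensor field is the family of its components: \<open>X c p\<close> is the value at the point \<open>p\<close> in the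
  chart \<open>c\<close>, meaningful only for \<open>p \<in> fst c\<close>.

  \<open>chart_deriv c F p v\<close> is the derivative of \<open>F\<close> at \<open>p\<close> in the coordinate direction \<open>v\<close> of the
  chart \<open>c\<close>; \<open>dmap c d f p\<close> is the differential of \<open>f\<close> at \<open>p\<close> in the charts \<open>c\<close> (source) and
  \<open>d\<close> (target).  In particular \<open>dmap c d (\<lambda>q. q) p\<close> is the derivative of the coordinate change from
  \<open>c\<close> to \<open>d\<close>.
\<close>

definition chart_deriv ::
  "('a, 'm::euclidean_space) chart \<Rightarrow> ('a \<Rightarrow> 'n::real_normed_vector) \<Rightarrow> 'a \<Rightarrow> 'm \<Rightarrow> 'n" where
  "chart_deriv c F p = frechet_derivative (\<lambda>y. F (chart_inv c y)) (at (snd c p))"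

definition dmap ::
  "('a, 'm::euclidean_space) chart \<Rightarrow> ('b, 'n::euclidean_space) chart \<Rightarrow> ('a \<Rightarrow> 'b) \<Rightarrow> 'a \<Rightarrow> 'm \<Rightarrow> 'n" where
  "dmap c d f p = chart_deriv c (\<lambda>q. snd d (f q)) p"

type_synonym ('a, 'm) vfield = "('a, 'm) chart \<Rightarrow> 'a \<Rightarrow> 'm"
type_synonym ('a, 'm) covfield = "('a, 'm) chart \<Rightarrow> 'a \<Rightarrow> 'm \<Rightarrow> real"
type_synonym ('a, 'm) bilfield = "('a, 'm) chart \<Rightarrow> 'a \<Rightarrow> 'm \<Rightarrow> 'm \<Rightarrow> real"
type_synonym ('a, 'm) endfield = "('a, 'm) chart \<Rightarrow> 'a \<Rightarrow> 'm \<Rightarrow> 'm"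

definition vector_field :: "('a, 'm::euclidean_space) chart set \<Rightarrow> ('a, 'm) vfield \<Rightarrow> bool" where
  "vector_field A X \<longleftrightarrow>
     (\<forall>c\<in>A. smooth_on (snd c ` fst c) (\<lambda>y. X c (chart_inv c y))) \<and>
     (\<forall>c\<in>A. \<forall>d\<in>A. \<forall>p \<in> fst c \<inter> fst d. X d p = dmap c d (\<lambda>q. q) p (X c p))"

definition one_form :: "('a, 'm::euclidean_space) chart set \<Rightarrow> ('a, 'm) covfield \<Rightarrow> bool" where
  "one_form A \<eta> \<longleftrightarrow>
     (\<forall>c\<in>A. \<forall>p \<in> fst c. linear (\<eta> c p)) \<and>
     (\<forall>c\<in>A. \<forall>v. smooth_on (snd c ` fst c) (\<lambda>y. \<eta> c (chart_inv c y) v)) \<and>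
     (\<forall>c\<in>A. \<forall>d\<in>A. \<forall>p \<in> fst c \<inter> fst d. \<forall>v. \<eta> c p v = \<eta> d p (dmap c d (\<lambda>q. q) p v))"

definition bilinear_field :: "('a, 'm::euclidean_space) chart set \<Rightarrow> ('a, 'm) bilfield \<Rightarrow> bool" where
  "bilinear_field A h \<longleftrightarrow>
     (\<forall>c\<in>A. \<forall>p \<in> fst c. bilinear (h c p)) \<and>
     (\<forall>c\<in>A. \<forall>v w. smooth_on (snd c ` fst c) (\<lambda>y. h c (chart_inv c y) v w)) \<and>
     (\<forall>c\<in>A. \<forall>d\<in>A. \<forall>p \<in> fst c \<inter> fst d. \<forall>v w.
        h c p v w = h d p (dmap c d (\<lambda>q. q) p v) (dmap c d (\<lambda>q. q) p w))"

definition endo_field :: "('a, 'm::euclidean_space) chart set \<Rightarrow> ('a, 'm) endfield \<Rightarrow> bool" where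
  "endo_field A \<phi> \<longleftrightarrow>
     (\<forall>c\<in>A. \<forall>p \<in> fst c. linear (\<phi> c p)) \<and>
     (\<forall>c\<in>A. \<forall>v. smooth_on (snd c ` fst c) (\<lambda>y. \<phi> c (chart_inv c y) v)) \<and>
     (\<forall>c\<in>A. \<forall>d\<in>A. \<forall>p \<in> fst c \<inter> fst d. \<forall>v.
        \<phi> d p (dmap c d (\<lambda>q. q) p v) = dmap c d (\<lambda>q. q) p (\<phi> c p v))"

definition two_form :: "('a, 'm::euclidean_space) chart set \<Rightarrow> ('a, 'm) bilfield \<Rightarrow> bool" where
  "two_form A \<omega> \<longleftrightarrow> bilinear_field A \<omega> \<and> (\<forall>c\<in>A. \<forall>p \<in> fst c. \<forall>v w. \<omega> c p v w = - \<omega> c p w v)"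

definition riemannian_metric :: "('a, 'm::euclidean_space) chart set \<Rightarrow> ('a, 'm) bilfield \<Rightarrow> bool" where
  "riemannian_metric A g \<longleftrightarrow> bilinear_field A g \<and>
     (\<forall>c\<in>A. \<forall>p \<in> fst c. (\<forall>v w. g c p v w = g c p w v) \<and> (\<forall>v. v \<noteq> 0 \<longrightarrow> 0 < g c p v v))"

text \<open>
  Exterior derivatives, in the normalisation
  \<open>d\<eta>(X, Y) = X(\<eta>(Y)) - Y(\<eta>(X)) - \<eta>([X, Y])\<close> (no factor 1/2).  The bracket terms do not
  appear since \<open>v\<close>, \<open>w\<close>, \<open>u\<close> are constant coordinate fields.
\<close>

definition ext_deriv :: "('a, 'm::euclidean_space) covfield \<Rightarrow> ('a, 'm) bilfield" where
  "ext_deriv \<eta> c p v w = chart_deriv c (\<lambda>q. \<eta> c q w) p v - chart_deriv c (\<lambda>q. \<eta> c q v) p w"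

definition closed_form2 :: "('a, 'm::euclidean_space) chart set \<Rightarrow> ('a, 'm) bilfield \<Rightarrow> bool" where
  "closed_form2 A \<omega> \<longleftrightarrow> (\<forall>c\<in>A. \<forall>p \<in> fst c. \<forall>u v w.
     chart_deriv c (\<lambda>q. \<omega> c q v w) p u + chart_deriv c (\<lambda>q. \<omega> c q w u) p v
       + chart_deriv c (\<lambda>q. \<omega> c q u v) p w = 0)"

text \<open>
  Lie derivative of a bilinear tensor field:
  \<open>(L\<^sub>X h)(v, w) = X(h(v, w)) - h([X, v], w) - h(v, [X, w])\<close>, where for constant
  coordinate fields \<open>[X, v] = - \<partial>\<^sub>v X\<close>.
\<close>

definition lie_deriv :: "('a, 'm::euclidean_space) vfield \<Rightarrow> ('a, 'm) bilfield \<Rightarrow> ('a, 'm) bilfield" where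
  "lie_deriv X h c p v w = chart_deriv c (\<lambda>q. h c q v w) p (X c p)
     + h c p (chart_deriv c (X c) p v) w + h c p v (chart_deriv c (X c) p w)"

definition killing :: "('a, 'm::euclidean_space) chart set \<Rightarrow> ('a, 'm) bilfield \<Rightarrow> ('a, 'm) vfield \<Rightarrow> bool" where
  "killing A g X \<longleftrightarrow> (\<forall>c\<in>A. \<forall>p \<in> fst c. \<forall>v w. lie_deriv X g c p v w = 0)"

text \<open>
  Alternating \<open>k\<close>-forms on a vector space, as functions of sequences \<open>v\<close> of vectors of which only
  \<open>v 0, \<dots>, v (k - 1)\<close> are used; \<open>wedge k l\<close> is the exterior product of a \<open>k\<close>-form and an \<open>l\<close>-form,
  \<open>wedge_power n \<beta>\<close> the \<open>n\<close>-th exterior power of a 2-form.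
\<close>

definition wedge ::
  "nat \<Rightarrow> nat \<Rightarrow> ((nat \<Rightarrow> 'v) \<Rightarrow> real) \<Rightarrow> ((nat \<Rightarrow> 'v) \<Rightarrow> real) \<Rightarrow> (nat \<Rightarrow> 'v) \<Rightarrow> real" where
  "wedge k l \<alpha> \<beta> v =
     (\<Sum>\<sigma> | \<sigma> permutes {..<k + l}. real_of_int (sign \<sigma>) * \<alpha> (\<lambda>i. v (\<sigma> i)) * \<beta> (\<lambda>i. v (\<sigma> (k + i))))
       / (fact k * fact l)"

primrec wedge_power :: "nat \<Rightarrow> ((nat \<Rightarrow> 'v) \<Rightarrow> real) \<Rightarrow> (nat \<Rightarrow> 'v) \<Rightarrow> real" where
  "wedge_power 0 \<beta> = (\<lambda>v. 1)"
| "wedge_power (Suc n) \<beta> = wedge 2 (2 * n) \<beta> (wedge_power n \<beta>)"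

section \<open>Contact metric and symplectic metric manifolds\<close>

definition contact_form :: "nat \<Rightarrow> ('a, 'm::euclidean_space) chart set \<Rightarrow> ('a, 'm) covfield \<Rightarrow> bool" where
  "contact_form n A \<eta> \<longleftrightarrow> DIM('m) = 2 * n + 1 \<and> one_form A \<eta> \<and>
     (\<forall>c\<in>A. \<forall>p \<in> fst c. \<exists>v.
        wedge 1 (2 * n) (\<lambda>v. \<eta> c p (v 0)) (wedge_power n (\<lambda>v. ext_deriv \<eta> c p (v 0) (v 1))) v \<noteq> 0)"

definition reeb_field ::
  "('a, 'm::euclidean_space) chart set \<Rightarrow> ('a, 'm) covfield \<Rightarrow> ('a, 'm) vfield \<Rightarrow> bool" where
  "reeb_field A \<eta> \<xi> \<longleftrightarrow> vector_field A \<xi> \<and>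
     (\<forall>c\<in>A. \<forall>p \<in> fst c. \<eta> c p (\<xi> c p) = 1 \<and> (\<forall>v. ext_deriv \<eta> c p (\<xi> c p) v = 0))"

definition contact_metric ::
  "nat \<Rightarrow> ('a::{t2_space, second_countable_topology}, 'm::euclidean_space) chart set \<Rightarrow> ('a, 'm) covfield \<Rightarrow>
   ('a, 'm) vfield \<Rightarrow> ('a, 'm) bilfield \<Rightarrow> ('a, 'm) endfield \<Rightarrow> bool" where
  "contact_metric n A \<eta> \<xi> g \<phi> \<longleftrightarrow>
     smooth_atlas A \<and> contact_form n A \<eta> \<and> reeb_field A \<eta> \<xi> \<and>
     riemannian_metric A g \<and> endo_field A \<phi> \<and>
     (\<forall>c\<in>A. \<forall>p \<in> fst c.
        (\<forall>v. \<eta> c p v = g c p (\<xi> c p) v) \<and>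
        (\<forall>v. \<phi> c p (\<phi> c p v) = - v + \<eta> c p v *\<^sub>R \<xi> c p) \<and>
        (\<forall>v w. ext_deriv \<eta> c p v w = g c p v (\<phi> c p w)))"

definition K_contact ::
  "nat \<Rightarrow> ('a::{t2_space, second_countable_topology}, 'm::euclidean_space) chart set \<Rightarrow> ('a, 'm) covfield \<Rightarrow>
   ('a, 'm) vfield \<Rightarrow> ('a, 'm) bilfield \<Rightarrow> ('a, 'm) endfield \<Rightarrow> bool" where
  "K_contact n A \<eta> \<xi> g \<phi> \<longleftrightarrow> contact_metric n A \<eta> \<xi> g \<phi> \<and> killing A g \<xi>"

definition symplectic_form :: "('b, 'n::euclidean_space) chart set \<Rightarrow> ('b, 'n) bilfield \<Rightarrow> bool" where
  "symplectic_form B \<omega> \<longleftrightarrow> two_form B \<omega> \<and> closed_form2 B \<omega> \<and>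
     (\<forall>c\<in>B. \<forall>p \<in> fst c. \<forall>v. (\<forall>w. \<omega> c p v w = 0) \<longrightarrow> v = 0)"

definition almost_complex :: "('b, 'n::euclidean_space) chart set \<Rightarrow> ('b, 'n) endfield \<Rightarrow> bool" where
  "almost_complex B J \<longleftrightarrow> endo_field B J \<and> (\<forall>c\<in>B. \<forall>p \<in> fst c. \<forall>v. J c p (J c p v) = - v)"

definition symplectic_metric ::
  "('b::{t2_space, second_countable_topology}, 'n::euclidean_space) chart set \<Rightarrow> ('b, 'n) bilfield \<Rightarrow>
   ('b, 'n) bilfield \<Rightarrow> ('b, 'n) endfield \<Rightarrow> bool" where
  "symplectic_metric B \<omega> g J \<longleftrightarrow>
     smooth_atlas B \<and> symplectic_form B \<omega> \<and> riemannian_metric B g \<and> almost_complex B J \<and>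
     (\<forall>c\<in>B. \<forall>p \<in> fst c. \<forall>v w. g c p v (J c p w) = \<omega> c p v w)"

section \<open>Regularity and the Boothby--Wang fibration\<close>

definition integral_curve ::
  "('a::topological_space, 'm::euclidean_space) chart set \<Rightarrow> ('a, 'm) vfield \<Rightarrow> real set \<Rightarrow> (real \<Rightarrow> 'a) \<Rightarrow> bool" where
  "integral_curve A X I \<gamma> \<longleftrightarrow> open I \<and> is_interval I \<and> continuous_on I \<gamma> \<and>
     (\<forall>t\<in>I. \<forall>c\<in>A. \<gamma> t \<in> fst c \<longrightarrow>
        ((\<lambda>s. snd c (\<gamma> s)) has_vector_derivative X c (\<gamma> t)) (at t))"

text \<open>
  A flow box is a compatible chart onto an open box in which \<open>X\<close> is the constant coordinate
  field \<open>e\<close>.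
\<close>

definition flow_box ::
  "('a::{t2_space, second_countable_topology}, 'm::euclidean_space) chart set \<Rightarrow> ('a, 'm) vfield \<Rightarrow>
   ('a, 'm) chart \<Rightarrow> 'm \<Rightarrow> bool" where
  "flow_box A X b e \<longleftrightarrow> smooth_atlas (insert b A) \<and> e \<in> Basis \<and> (\<exists>l u. snd b ` fst b = box l u) \<and>
     (\<forall>c\<in>A. \<forall>p \<in> fst c \<inter> fst b. dmap c b (\<lambda>q. q) p (X c p) = e)"

text \<open>
  An integral curve pierces the flow box at most once if all its points in the box lie on one and
  the same line parallel to \<open>e\<close>.  (A periodic curve may run through that segment repeatedly.)
\<close>

definition regular_field ::
  "('a::{t2_space, second_countable_topology}, 'm::euclidean_space) chart set \<Rightarrow> ('a, 'm) vfield \<Rightarrow> bool" where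
  "regular_field A X \<longleftrightarrow> (\<forall>p. \<exists>b e. flow_box A X b e \<and> p \<in> fst b \<and>
     (\<forall>I \<gamma>. integral_curve A X I \<gamma> \<longrightarrow>
        (\<forall>s\<in>I. \<forall>t\<in>I. \<gamma> s \<in> fst b \<longrightarrow> \<gamma> t \<in> fst b \<longrightarrow> snd b (\<gamma> s) - snd b (\<gamma> t) \<in> span {e})))"

text \<open>
  \<open>\<Phi>\<close> is the flow of \<open>X\<close>, and it descends to a free action of the circle \<open>\<real>/T\<int>\<close>.  The period \<open>T\<close>
  is left arbitrary, which covers the usual normalisations \<open>1\<close> and \<open>2\<pi>\<close>.
\<close>

definition free_circle_flow ::
  "('a::{t2_space, second_countable_topology}, 'm::euclidean_space) chart set \<Rightarrow> ('a, 'm) vfield \<Rightarrow>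
   real \<Rightarrow> (real \<Rightarrow> 'a \<Rightarrow> 'a) \<Rightarrow> bool" where
  "free_circle_flow A X T \<Phi> \<longleftrightarrow> 0 < T \<and>
     smooth_map (prod_atlas eucl_atlas A) A (\<lambda>(t, p). \<Phi> t p) \<and>
     (\<forall>p. \<Phi> 0 p = p) \<and> (\<forall>s t p. \<Phi> (s + t) p = \<Phi> s (\<Phi> t p)) \<and>
     (\<forall>p. integral_curve A X UNIV (\<lambda>t. \<Phi> t p)) \<and>
     (\<forall>t p. \<Phi> t p = p \<longleftrightarrow> (\<exists>k::int. t = of_int k * T))"

text \<open>
  Principal circle bundle for the action \<open>\<Phi>\<close>: the fibres are the orbits, and locally over the base
  \<open>p \<mapsto> (\<pi> p, \<theta> p)\<close> is an equivariant diffeomorphism of \<open>\<pi> -` U\<close> onto \<open>U \<times> S\<^sup>1\<close>, where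
  \<open>S\<^sup>1 \<subseteq> \<complex>\<close>; \<open>\<psi>\<close> is its inverse, whose smoothness on \<open>U \<times> S\<^sup>1\<close> is expressed through the
  covering \<open>cis : \<real> \<rightarrow> S\<^sup>1\<close>, a local diffeomorphism.
\<close>

definition local_trivialization ::
  "('a::{t2_space, second_countable_topology}, 'm::euclidean_space) chart set \<Rightarrow>
   ('b::{t2_space, second_countable_topology}, 'n::euclidean_space) chart set \<Rightarrow>
   ('a \<Rightarrow> 'b) \<Rightarrow> real \<Rightarrow> (real \<Rightarrow> 'a \<Rightarrow> 'a) \<Rightarrow> 'b set \<Rightarrow> ('a \<Rightarrow> complex) \<Rightarrow> ('b \<Rightarrow> complex \<Rightarrow> 'a) \<Rightarrow> bool" where
  "local_trivialization A B \<pi> T \<Phi> U \<theta> \<psi> \<longleftrightarrow> open U \<and>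
     smooth_map_on A eucl_atlas (\<pi> -` U) \<theta> \<and>
     smooth_map_on (prod_atlas B eucl_atlas) A (U \<times> UNIV) (\<lambda>(u, s::real). \<psi> u (cis s)) \<and>
     (\<forall>p \<in> \<pi> -` U. cmod (\<theta> p) = 1 \<and> \<psi> (\<pi> p) (\<theta> p) = p) \<and>
     (\<forall>u\<in>U. \<forall>z. cmod z = 1 \<longrightarrow> \<pi> (\<psi> u z) = u \<and> \<theta> (\<psi> u z) = z) \<and>
     (\<forall>p \<in> \<pi> -` U. \<forall>t. \<theta> (\<Phi> t p) = cis (2 * pi * t / T) * \<theta> p)"

definition principal_circle_bundle ::
  "('a::{t2_space, second_countable_topology}, 'm::euclidean_space) chart set \<Rightarrow>
   ('b::{t2_space, second_countable_topology}, 'n::euclidean_space) chart set \<Rightarrow>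
   ('a \<Rightarrow> 'b) \<Rightarrow> real \<Rightarrow> (real \<Rightarrow> 'a \<Rightarrow> 'a) \<Rightarrow> bool" where
  "principal_circle_bundle A B \<pi> T \<Phi> \<longleftrightarrow> smooth_map A B \<pi> \<and>
     (\<forall>p q. \<pi> p = \<pi> q \<longleftrightarrow> (\<exists>t. q = \<Phi> t p)) \<and>
     (\<forall>b. \<exists>U \<theta> \<psi>. b \<in> U \<and> local_trivialization A B \<pi> T \<Phi> U \<theta> \<psi>)"

definition boothby_wang ::
  "('a::{t2_space, second_countable_topology}, 'm::euclidean_space) chart set \<Rightarrow> ('a, 'm) covfield \<Rightarrow> ('a, 'm) vfield \<Rightarrow>
   ('b::{t2_space, second_countable_topology}, 'n::euclidean_space) chart set \<Rightarrow> ('b, 'n) bilfield \<Rightarrow>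
   ('a \<Rightarrow> 'b) \<Rightarrow> bool" where
  "boothby_wang A \<eta> \<xi> B \<omega> \<pi> \<longleftrightarrow>
     (\<exists>T \<Phi>. free_circle_flow A \<xi> T \<Phi> \<and> principal_circle_bundle A B \<pi> T \<Phi>) \<and>
     (\<forall>c\<in>A. \<forall>d\<in>B. \<forall>p \<in> fst c \<inter> \<pi> -` fst d. \<forall>v w.
        \<omega> d (\<pi> p) (dmap c d \<pi> p v) (dmap c d \<pi> p w) = ext_deriv \<eta> c p v w)"

section \<open>Conformal and Riemannian submersions\<close>

definition submersion ::
  "('a::topological_space, 'm::euclidean_space) chart set \<Rightarrow>
   ('b::topological_space, 'n::euclidean_space) chart set \<Rightarrow> ('a \<Rightarrow> 'b) \<Rightarrow> bool" where
  "submersion A B \<pi> \<longleftrightarrow> smooth_map A B \<pi> \<and>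
     (\<forall>c\<in>A. \<forall>d\<in>B. \<forall>p \<in> fst c \<inter> \<pi> -` fst d. surj (dmap c d \<pi> p))"

definition contact_distribution ::
  "('a, 'm::euclidean_space) covfield \<Rightarrow> ('a, 'm) chart \<Rightarrow> 'a \<Rightarrow> 'm set" where
  "contact_distribution \<eta> c p = {v. \<eta> c p v = 0}"

definition conformal_submersion ::
  "('a::topological_space, 'm::euclidean_space) chart set \<Rightarrow> ('a, 'm) covfield \<Rightarrow> ('a, 'm) bilfield \<Rightarrow>
   ('b::topological_space, 'n::euclidean_space) chart set \<Rightarrow> ('b, 'n) bilfield \<Rightarrow> ('a \<Rightarrow> 'b) \<Rightarrow> bool" where
  "conformal_submersion A \<eta> gM B gB \<pi> \<longleftrightarrow> submersion A B \<pi> \<and>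
     (\<exists>f :: 'a \<Rightarrow> real. smooth_map A eucl_atlas f \<and>
       (\<forall>c\<in>A. \<forall>d\<in>B. \<forall>p \<in> fst c \<inter> \<pi> -` fst d.
          \<forall>v \<in> contact_distribution \<eta> c p. \<forall>w \<in> contact_distribution \<eta> c p.
            gM c p v w = exp (2 * f p) * gB d (\<pi> p) (dmap c d \<pi> p v) (dmap c d \<pi> p w)))"

definition riemannian_submersion ::
  "('a::topological_space, 'm::euclidean_space) chart set \<Rightarrow> ('a, 'm) covfield \<Rightarrow> ('a, 'm) bilfield \<Rightarrow>
   ('b::topological_space, 'n::euclidean_space) chart set \<Rightarrow> ('b, 'n) bilfield \<Rightarrow> ('a \<Rightarrow> 'b) \<Rightarrow> bool" where
  "riemannian_submersion A \<eta> gM B gB \<pi> \<longleftrightarrow> submersion A B \<pi> \<and>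
     (\<forall>c\<in>A. \<forall>d\<in>B. \<forall>p \<in> fst c \<inter> \<pi> -` fst d.
        dmap c d \<pi> p ` contact_distribution \<eta> c p = UNIV \<and>
        (\<forall>v \<in> contact_distribution \<eta> c p. \<forall>w \<in> contact_distribution \<eta> c p.
           gM c p v w = gB d (\<pi> p) (dmap c d \<pi> p v) (dmap c d \<pi> p w)))"

end

theory Submission
  imports Defs
begin

text \<open>
  On \<open>ker \<eta>\<close> the identity \<open>gM(v, \<phi> w) = d\<eta>(v, w) = gB(d\<pi> v, J d\<pi> w)\<close> and conformality with factor
  \<open>s = e\<^bsup>2f\<^esup>\<close> give \<open>J d\<pi> = s d\<pi> \<phi>\<close>.  Squaring, with \<open>J\<^sup>2 = -1\<close> and \<open>\<phi>\<^sup>2 = -1\<close> on \<open>ker \<eta>\<close>, yields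
  \<open>s\<^sup>2 = 1\<close>, so \<open>gM = \<eta> \<otimes> \<eta> + \<pi>\<^sup>* gB\<close>.  Both summands are invariant under the Reeb field \<open>\<xi>\<close>: the first
  since \<open>\<eta>(\<xi>) = 1\<close> and \<open>i\<^sub>\<xi> d\<eta> = 0\<close>, the second since \<open>d\<pi>(\<xi>) = 0\<close>.
\<close>

section \<open>Symmetry of second derivatives\<close>

text \<open>
  Only differentiability of \<open>y \<mapsto> f' y v\<close> at the single point \<open>x\<close> is available, so the mean value
  theorem is applied to \<open>s \<mapsto> f (x + s v + t w) - f (x + s v) - s t (A w)\<close>, whose derivative is \<open>o(t)\<close>.
\<close>

lemma second_difference_bound:
  fixes f :: "'a::real_normed_vector \<Rightarrow> 'b::real_inner"
  assumes S: "open S" "x \<in> S"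
    and f: "\<And>y. y \<in> S \<Longrightarrow> (f has_derivative f' y) (at y)"
    and A: "((\<lambda>y. f' y v) has_derivative A) (at x)"
    and e: "e > 0"
  shows "\<exists>\<delta>>0. \<forall>t. 0 < t \<and> t < \<delta> \<longrightarrow>
    norm (f (x + t *\<^sub>R v + t *\<^sub>R w) - f (x + t *\<^sub>R v) - f (x + t *\<^sub>R w) + f x - t\<^sup>2 *\<^sub>R A w) \<le> e * t\<^sup>2"
proof -
  \<comment> \<open>For \<open>s\<close> in \<open>[0, t]\<close> the points \<open>p s\<close> and
    \<open>q s\<close> below lie within \<open>t * K\<close> of \<open>x\<close>; the summand
    \<open>1\<close> keeps \<open>K\<close> positive when \<open>v = w = 0\<close>.\<close>
  define K where "K = norm v + norm w + 1"
  have K: "K > 0" unfolding K_def by (smt (verit) norm_ge_zero)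
  interpret A: bounded_linear A using A by (rule has_derivative_bounded_linear)
  obtain d1 where d1: "d1 > 0" "ball x d1 \<subseteq> S"
    using S open_contains_ball by blast
  \<comment> \<open>At distance at most \<open>t * K\<close> this tolerance gives an error
    \<open>e / 2 * t\<close> at each of the two points; the mean value theorem supplies the
    remaining factor \<open>t\<close>.\<close>
  have "e / (2 * K) > 0" using e K by simp
  then obtain d2 where d2: "d2 > 0"
    "\<And>y. norm (y - x) < d2 \<Longrightarrow> norm (f' y v - f' x v - A (y - x)) \<le> e / (2 * K) * norm (y - x)"
    using A unfolding has_derivative_at_alt by blast
  define \<delta> where "\<delta> = min d1 d2 / K"
  have "norm (f (x + t *\<^sub>R v + t *\<^sub>R w) - f (x + t *\<^sub>R v) - f (x + t *\<^sub>R w) + f x - t\<^sup>2 *\<^sub>R A w) \<le> e * t\<^sup>2"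
    if t: "0 < t" "t < \<delta>" for t
  proof -
    have tK: "t * K < d1" "t * K < d2"
      using t K unfolding \<delta>_def by (simp_all add: pos_less_divide_eq)
    define p where "p = (\<lambda>s. x + s *\<^sub>R v + t *\<^sub>R w)"
    define q where "q = (\<lambda>s. x + s *\<^sub>R v)"
    have pn: "norm (p s - x) \<le> t * K" and qn: "norm (q s - x) \<le> t * K" if s: "s \<in> {0..t}" for s
    proof -
      have "norm (p s - x) \<le> \<bar>s\<bar> * norm v + \<bar>t\<bar> * norm w"
        unfolding p_def by (simp add: norm_triangle_le)
      also have "\<dots> \<le> t * norm v + t * norm w"
        using s t by (intro add_mono mult_right_mono) auto
      also have "\<dots> \<le> t * K" using t unfolding K_def by (simp add: distrib_left)
      finally show "norm (p s - x) \<le> t * K" .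
      have "norm (q s - x) = \<bar>s\<bar> * norm v" unfolding q_def by simp
      also have "\<dots> \<le> t * norm v" using s by (intro mult_right_mono) auto
      also have "\<dots> \<le> t * K" using t unfolding K_def by (simp add: distrib_left)
      finally show "norm (q s - x) \<le> t * K" .
    qed
    have mem: "p s \<in> S" "q s \<in> S" if "s \<in> {0..t}" for s
      using pn[OF that] qn[OF that] tK d1(2) by (auto simp: dist_norm norm_minus_commute)
    define g where "g = (\<lambda>s. f (p s) - f (q s) - (s * t) *\<^sub>R A w)"
    define g' where "g' = (\<lambda>s h. f' (p s) (h *\<^sub>R v) - f' (q s) (h *\<^sub>R v) - (h * t) *\<^sub>R A w)"
    have dg: "(g has_derivative g' s) (at s)" if s: "s \<in> {0..t}" for s
    proof -
      have "((\<lambda>s. f (p s)) has_derivative (\<lambda>h. f' (p s) (h *\<^sub>R v))) (at s)"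
        by (rule has_derivative_compose[of p _ s UNIV f, OF _ f[OF mem(1)[OF s]]])
          (auto simp: p_def intro!: derivative_eq_intros)
      moreover have "((\<lambda>s. f (q s)) has_derivative (\<lambda>h. f' (q s) (h *\<^sub>R v))) (at s)"
        by (rule has_derivative_compose[of q _ s UNIV f, OF _ f[OF mem(2)[OF s]]])
          (auto simp: q_def intro!: derivative_eq_intros)
      moreover have "((\<lambda>s. (s * t) *\<^sub>R A w) has_derivative (\<lambda>h. (h * t) *\<^sub>R A w)) (at s)"
        by (auto intro!: derivative_eq_intros)
      ultimately show ?thesis unfolding g_def g'_def by (intro has_derivative_diff)
    qed
    have "\<exists>s\<in>{0<..<t}. norm (g t - g 0) \<le> norm (g' s (t - 0))"
    proof (rule mvt_general)
      show "continuous_on {0..t} g"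
        using dg by (meson continuous_at_imp_continuous_on has_derivative_continuous)
    qed (use t dg in auto)
    then obtain s where s: "s \<in> {0<..<t}" "norm (g t - g 0) \<le> norm (g' s t)" by auto
    have s': "s \<in> {0..t}" using s by auto
    have hom: "f' y (t *\<^sub>R v) = t *\<^sub>R f' y v" if "y \<in> S" for y
      using has_derivative_linear[OF f[OF that]] by (rule linear_cmul)
    have g's: "g' s t = t *\<^sub>R (f' (p s) v - f' (q s) v - A (t *\<^sub>R w))"
      unfolding g'_def using mem[OF s'] by (simp add: hom A.scaleR algebra_simps)
    \<comment> \<open>With \<open>t w\<close> as a difference of displacements from
      \<open>x\<close>, the term \<open>f' x v\<close> cancels and two linear approximation errors
      at \<open>x\<close> remain.\<close>
    have tw: "t *\<^sub>R w = (p s - x) - (q s - x)" unfolding p_def q_def by simp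
    have eq: "f' (p s) v - f' (q s) v - A (t *\<^sub>R w)
      = (f' (p s) v - f' x v - A (p s - x)) - (f' (q s) v - f' x v - A (q s - x))"
      unfolding tw A.diff by simp
    have b: "norm (f' y v - f' x v - A (y - x)) \<le> e / 2 * t" if y: "norm (y - x) \<le> t * K" for y
    proof -
      have "norm (f' y v - f' x v - A (y - x)) \<le> e / (2 * K) * norm (y - x)"
        using y tK d2(2) by force
      also have "\<dots> \<le> e / (2 * K) * (t * K)" using e K y by (intro mult_left_mono) auto
      also have "\<dots> = e / 2 * t" using K by simp
      finally show ?thesis .
    qed
    have "norm (f' (p s) v - f' (q s) v - A (t *\<^sub>R w)) \<le> e / 2 * t + e / 2 * t"
      unfolding eq using b[OF pn[OF s']] b[OF qn[OF s']]
      by (meson add_mono norm_triangle_ineq4 order_trans)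
    then have "norm (g' s t) \<le> t * (e * t)"
      unfolding g's using t by simp
    then have "norm (g t - g 0) \<le> e * t\<^sup>2"
      using s by (simp add: power2_eq_square mult_ac)
    moreover have "g t - g 0 = f (x + t *\<^sub>R v + t *\<^sub>R w) - f (x + t *\<^sub>R v) - f (x + t *\<^sub>R w) + f x - t\<^sup>2 *\<^sub>R A w"
      unfolding g_def p_def q_def by (simp add: power2_eq_square)
    ultimately show ?thesis by simp
  qed
  moreover have "\<delta> > 0" unfolding \<delta>_def using d1 d2 K by simp
  ultimately show ?thesis by blast
qed

text \<open>The second difference of \<open>f\<close> does not change when \<open>v\<close> and
  \<open>w\<close> are swapped, and up to \<open>o(t^2)\<close> it equals both
  \<open>t^2 A w\<close> and \<open>t^2 B v\<close>.\<close>

lemma second_derivative_symmetric: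
  fixes f :: "'a::real_normed_vector \<Rightarrow> 'b::real_inner"
  assumes S: "open S" "x \<in> S"
    and f: "\<And>y. y \<in> S \<Longrightarrow> (f has_derivative f' y) (at y)"
    and A: "((\<lambda>y. f' y v) has_derivative A) (at x)"
    and B: "((\<lambda>y. f' y w) has_derivative B) (at x)"
  shows "A w = B v"
proof -
  have "norm (A w - B v) \<le> e" if e: "e > 0" for e
  proof -
    have e2: "e / 2 > 0" using e by simp
    from second_difference_bound[OF S f A e2, of w] second_difference_bound[OF S f B e2, of v]
    obtain a b where ab: "a > 0" "b > 0"
      "\<And>t. 0 < t \<and> t < a \<Longrightarrow> norm (f (x + t *\<^sub>R v + t *\<^sub>R w) - f (x + t *\<^sub>R v) - f (x + t *\<^sub>R w) + f x - t\<^sup>2 *\<^sub>R A w) \<le> e / 2 * t\<^sup>2"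
      "\<And>t. 0 < t \<and> t < b \<Longrightarrow> norm (f (x + t *\<^sub>R w + t *\<^sub>R v) - f (x + t *\<^sub>R w) - f (x + t *\<^sub>R v) + f x - t\<^sup>2 *\<^sub>R B v) \<le> e / 2 * t\<^sup>2"
      by blast
    define t where "t = min a b / 2"
    have t: "0 < t" "t < a" "t < b" unfolding t_def using ab by auto
    define D where "D = f (x + t *\<^sub>R v + t *\<^sub>R w) - f (x + t *\<^sub>R v) - f (x + t *\<^sub>R w) + f x"
    have 1: "norm (D - t\<^sup>2 *\<^sub>R A w) \<le> e / 2 * t\<^sup>2"
      unfolding D_def using ab(3) t by blast
    have 2: "norm (D - t\<^sup>2 *\<^sub>R B v) \<le> e / 2 * t\<^sup>2"
      using ab(4)[of t] t unfolding D_def by (simp add: algebra_simps)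
    have "t\<^sup>2 *\<^sub>R (A w - B v) = (D - t\<^sup>2 *\<^sub>R B v) - (D - t\<^sup>2 *\<^sub>R A w)"
      by (simp add: algebra_simps)
    then have "norm (t\<^sup>2 *\<^sub>R (A w - B v)) \<le> e * t\<^sup>2"
      using 1 2 norm_triangle_ineq4[of "D - t\<^sup>2 *\<^sub>R B v" "D - t\<^sup>2 *\<^sub>R A w"] by simp
    then show ?thesis using t by (simp add: mult.commute)
  qed
  then have "norm (A w - B v) \<le> 0" by (meson dense_ge)
  then show ?thesis by simp
qed

section \<open>Lie derivatives in coordinates\<close>

text \<open>Product rule for evaluating a linear map that varies with the point. Differentiability
  is asked for each fixed \<open>v\<close> because tensor fields are smooth componentwise.\<close>

lemma has_derivative_linear_family:
  fixes L :: "'y::real_normed_vector \<Rightarrow> 'v::euclidean_space \<Rightarrow> 'r::real_normed_vector"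
  assumes S: "open S" "x \<in> S"
    and lin: "\<And>y. y \<in> S \<Longrightarrow> linear (L y)"
    and L: "\<And>v. ((\<lambda>y. L y v) has_derivative L' v) (at x)"
    and a: "(a has_derivative a') (at x)"
  shows "((\<lambda>y. L y (a y)) has_derivative (\<lambda>h. L' (a x) h + L x (a' h))) (at x)"
proof -
  have expand: "L y u = (\<Sum>i\<in>Basis. (u \<bullet> i) *\<^sub>R L y i)" if "y \<in> S" for y u
    using linear_sum[OF lin[OF that], of "\<lambda>i. (u \<bullet> i) *\<^sub>R i" Basis]
    by (simp add: euclidean_representation linear_cmul[OF lin[OF that]])
  \<comment> \<open>Freezing the argument at \<open>a x\<close> yields \<open>L' (a x)\<close>
    directly, without first showing that \<open>L' v\<close> is linear in \<open>v\<close>. The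
    coefficients in the sum vanish at \<open>x\<close>, so only \<open>L x (a' h)\<close> survives
    from it.\<close>
  have "((\<lambda>y. L y (a x) + (\<Sum>i\<in>Basis. ((a y - a x) \<bullet> i) *\<^sub>R L y i)) has_derivative
      (\<lambda>h. L' (a x) h + (\<Sum>i\<in>Basis. ((a x - a x) \<bullet> i) *\<^sub>R L' i h + (a' h \<bullet> i) *\<^sub>R L x i))) (at x)"
    by (intro has_derivative_add L has_derivative_sum has_derivative_scaleR)
      (auto intro!: derivative_eq_intros a)
  then have D: "((\<lambda>y. L y (a x) + (\<Sum>i\<in>Basis. ((a y - a x) \<bullet> i) *\<^sub>R L y i)) has_derivative
      (\<lambda>h. L' (a x) h + L x (a' h))) (at x)"
    by (simp add: expand[OF S(2), symmetric])
  show ?thesis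
    by (rule has_derivative_transform_within_open[OF D S])
      (simp add: expand[symmetric] linear_diff[OF lin])
qed

text \<open>The linear rule is applied twice: in the first slot with \<open>w\<close> fixed, then in
  the second slot with \<open>a y\<close> already inserted.\<close>

lemma has_derivative_bilinear_family:
  fixes G :: "'y::real_normed_vector \<Rightarrow> 'v::euclidean_space \<Rightarrow> 'w::euclidean_space \<Rightarrow> 'r::real_normed_vector"
  assumes S: "open S" "x \<in> S"
    and bil: "\<And>y. y \<in> S \<Longrightarrow> bilinear (G y)"
    and G: "\<And>v w. ((\<lambda>y. G y v w) has_derivative G' v w) (at x)"
    and a: "(a has_derivative a') (at x)"
    and b: "(b has_derivative b') (at x)"
  shows "((\<lambda>y. G y (a y) (b y)) has_derivative
    (\<lambda>h. G' (a x) (b x) h + G x (a' h) (b x) + G x (a x) (b' h))) (at x)"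
proof (rule has_derivative_linear_family[OF S, of "\<lambda>y. G y (a y)"
      "\<lambda>w h. G' (a x) w h + G x (a' h) w", OF _ _ b])
  show "linear (G y (a y))" if "y \<in> S" for y
    using bil[OF that] unfolding bilinear_def by blast
  show "((\<lambda>y. G y (a y) w) has_derivative (\<lambda>h. G' (a x) w h + G x (a' h) w)) (at x)" for w
    by (rule has_derivative_linear_family[OF S, of "\<lambda>y v. G y v w" "\<lambda>v. G' v w", OF _ G a])
      (use bil in \<open>auto simp: bilinear_def\<close>)
qed

text \<open>
  Differentiating \<open>dP(X) = 0\<close> and exchanging the derivatives gives
  \<open>\<partial>\<^sub>X (dP v) = - dP (\<partial>\<^sub>v X)\<close>, that is, \<open>L\<^sub>X\<close> kills pullbacks under \<open>P\<close>.
\<close>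

lemma pullback_has_derivative_vertical:
  fixes P :: "'m::euclidean_space \<Rightarrow> 'n::euclidean_space" and G :: "'n \<Rightarrow> 'n \<Rightarrow> 'n \<Rightarrow> real"
  assumes S: "open S" "x \<in> S"
    and P: "\<And>y. y \<in> S \<Longrightarrow> (P has_derivative P' y) (at y)"
    and P2: "\<And>v. (\<lambda>y. P' y v) differentiable (at x)"
    and X: "(X has_derivative X') (at x)"
    and vert: "\<And>y. y \<in> S \<Longrightarrow> P' y (X y) = 0"
    and bil: "\<And>y. y \<in> S \<Longrightarrow> bilinear (G (P y))"
    and G: "\<And>v w. (\<lambda>z. G z v w) differentiable (at (P x))"
  shows "\<exists>H. ((\<lambda>y. G (P y) (P' y v) (P' y w)) has_derivative H) (at x) \<and>
    H (X x) + G (P x) (P' x (X' v)) (P' x w) + G (P x) (P' x v) (P' x (X' w)) = 0"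
proof -
  obtain P'' where P'': "\<And>v. ((\<lambda>y. P' y v) has_derivative P'' v) (at x)"
    using P2 unfolding differentiable_def by metis
  obtain G' where G': "\<And>v w. ((\<lambda>z. G z v w) has_derivative G' v w) (at (P x))"
    using G unfolding differentiable_def by metis
  have linP: "linear (P' y)" if "y \<in> S" for y
    using P[OF that] by (rule has_derivative_linear)
  have "((\<lambda>y. P' y (X y)) has_derivative (\<lambda>h. P'' (X x) h + P' x (X' h))) (at x)"
    by (rule has_derivative_linear_family[OF S linP P'' X])
  moreover have "((\<lambda>y. P' y (X y)) has_derivative (\<lambda>h. 0)) (at x)"
    by (rule has_derivative_transform_within_open[OF has_derivative_const[of 0] S])
      (simp add: vert)
  ultimately have "P'' (X x) h + P' x (X' h) = 0" for h
    by (metis has_derivative_unique)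
  \<comment> \<open>Symmetry trades the derivative along \<open>h\<close> of the component in
    direction \<open>X x\<close> for the derivative along \<open>X x\<close>, the one that enters a
    Lie derivative.\<close>
  moreover have "P'' (X x) h = P'' h (X x)" for h
    by (rule second_derivative_symmetric[OF S P P'' P''])
  ultimately have key: "P'' h (X x) = - P' x (X' h)" for h
    by (metis eq_neg_iff_add_eq_0)
  have GP: "((\<lambda>y. G (P y) a b) has_derivative (\<lambda>h. G' a b (P' x h))) (at x)" for a b
    by (rule has_derivative_compose[OF P[OF S(2)] G'])
  have "((\<lambda>y. G (P y) (P' y v) (P' y w)) has_derivative
     (\<lambda>h. G' (P' x v) (P' x w) (P' x h) + G (P x) (P'' v h) (P' x w) + G (P x) (P' x v) (P'' w h))) (at x)"
    by (rule has_derivative_bilinear_family[OF S, of "\<lambda>y. G (P y)", OF bil GP P'' P''])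
  \<comment> \<open>At \<open>h = X x\<close> the displacement \<open>P' x h\<close> in the base is
    \<open>0\<close>, so the variation of \<open>G\<close> itself contributes nothing.\<close>
  moreover have "G' a b 0 = 0" for a b
    using has_derivative_linear[OF G'] by (rule linear_0)
  ultimately show ?thesis
    using S(2) bil[OF S(2)] by (auto simp: vert key bilinear_lneg bilinear_rneg)
qed

section \<open>Smooth maps in charts\<close>

lemma smooth_on_differentiable:
  assumes "smooth_on S f" "y \<in> S"
  shows "f differentiable (at y)"
proof -
  have "Ck_on (Suc 0) S f" using assms(1) unfolding smooth_on_def by blast
  then show ?thesis using assms(2) by simp
qed

lemma smooth_on_frechet_derivative_differentiable:
  assumes "smooth_on S f" "y \<in> S"
  shows "(\<lambda>y. frechet_derivative f (at y) v) differentiable (at y)"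
proof -
  have "Ck_on (Suc (Suc 0)) S f" using assms(1) unfolding smooth_on_def by blast
  then show ?thesis using assms(2) by simp
qed

lemma chart_inv_chart:
  assumes "is_chart c" "p \<in> fst c"
  shows "chart_inv c (snd c p) = p"
  using assms unfolding is_chart_def homeomorphism_def by blast

lemma open_chart_image:
  assumes "is_chart c" "open V" "V \<subseteq> fst c"
  shows "open (snd c ` V)"
proof -
  have c: "open (fst c)" "open (snd c ` fst c)"
    "homeomorphism (fst c) (snd c ` fst c) (snd c) (chart_inv c)"
    using assms(1) unfolding is_chart_def by auto
  have "openin (top_of_set (fst c)) V"
    using assms c(1) by (simp add: openin_open_eq)
  then have "openin (top_of_set (snd c ` fst c)) (snd c ` V)"
    using c(3) by (rule homeomorphism_imp_open_map[rotated])
  then show ?thesis using c(2) openin_open_trans by blast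
qed

lemma riemannian_metricD:
  assumes "riemannian_metric A g" "c \<in> A" "p \<in> fst c"
  shows "bilinear (g c p)" "g c p v w = g c p w v" "v \<noteq> 0 \<Longrightarrow> g c p v v > 0"
    "smooth_on (snd c ` fst c) (\<lambda>y. g c (chart_inv c y) v w)"
proof -
  have g: "bilinear_field A g"
    "\<forall>c\<in>A. \<forall>p \<in> fst c. (\<forall>v w. g c p v w = g c p w v) \<and> (\<forall>v. v \<noteq> 0 \<longrightarrow> 0 < g c p v v)"
    using assms(1) unfolding riemannian_metric_def by (rule conjunct1, rule conjunct2)
  note bilinear_fieldD = g(1)[unfolded bilinear_field_def]
  show "bilinear (g c p)"
    by (rule bilinear_fieldD[THEN conjunct1, rule_format, OF assms(2,3)])
  show "smooth_on (snd c ` fst c) (\<lambda>y. g c (chart_inv c y) v w)"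
    by (rule bilinear_fieldD[THEN conjunct2, THEN conjunct1, rule_format, OF assms(2)])
  note sym_pos = bspec[OF bspec[OF g(2) assms(2)] assms(3)]
  show "g c p v w = g c p w v" by (rule sym_pos[THEN conjunct1, rule_format])
  show "v \<noteq> 0 \<Longrightarrow> g c p v v > 0" by (rule sym_pos[THEN conjunct2, rule_format])
qed

section \<open>The conformal factor\<close>

text \<open>Linear algebra at one point: \<open>L\<close> stands for the differential of \<pi> and
  \<open>s\<close> for \<open>e^(2f)\<close>. The conclusion splits \<open>g\<close> instead of
  stating \<open>s = 1\<close>, since \<open>s\<close> is determined only when the target of
  \<open>L\<close> is nonzero.\<close>

lemma conformal_factor_trivial:
  fixes g :: "'v::real_vector \<Rightarrow> 'v \<Rightarrow> real" and h :: "'w::real_vector \<Rightarrow> 'w \<Rightarrow> real"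
    and L :: "'v \<Rightarrow> 'w" and s :: real
  assumes g: "bilinear g" "\<And>v w. g v w = g w v" "\<And>v. v \<noteq> 0 \<Longrightarrow> g v v > 0"
    and h: "bilinear h" "\<And>a. a \<noteq> 0 \<Longrightarrow> h a a > 0"
    and eta: "\<And>v. \<eta> v = g \<xi> v" "\<eta> \<xi> = 1"
    and phi: "\<And>v. \<phi> (\<phi> v) = - v + \<eta> v *\<^sub>R \<xi>"
    and xi: "\<And>v. g \<xi> (\<phi> v) = 0"
    and J: "linear J" "\<And>a. J (J a) = - a"
    and L: "linear L" "surj L"
    and pullback: "\<And>v w. h (L v) (J (L w)) = g v (\<phi> w)"
    and s: "s > 0"
    and conf: "\<And>v w. \<eta> v = 0 \<Longrightarrow> \<eta> w = 0 \<Longrightarrow> g v w = s * h (L v) (L w)"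
  shows "L \<xi> = 0" "L ` {v. \<eta> v = 0} = UNIV" "g v w = \<eta> v * \<eta> w + h (L v) (L w)"
proof -
  have nondeg: "a = 0" if "\<And>v. h (L v) a = 0" for a
    using that h(2) L(2) by (metis less_irrefl surjD)
  have "h (L \<xi>) (J (L w)) = 0" for w
    using pullback xi by simp
  then have "h (L \<xi>) (J b) = 0" for b
    using L(2) by (metis surjD)
  \<comment> \<open>Take \<open>b = J (L \<xi>)\<close>.\<close>
  then have "h (L \<xi>) (- L \<xi>) = 0"
    by (metis J(2))
  then have "h (L \<xi>) (L \<xi>) = 0"
    by (simp add: bilinear_rneg[OF h(1)])
  then show L\<xi>: "L \<xi> = 0" using h(2) by force
  \<comment> \<open>Conformality is known only on the kernel of \<eta>; this projection moves any
    vector there without changing its image under \<open>L\<close>.\<close>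
  define hor where "hor = (\<lambda>v. v - \<eta> v *\<^sub>R \<xi>)"
  have lin\<eta>: "linear \<eta>"
    using g(1) eta(1) unfolding bilinear_def by (metis (no_types, lifting) ext)
  have \<eta>hor: "\<eta> (hor v) = 0" for v
    unfolding hor_def by (simp add: linear_diff[OF lin\<eta>] linear_cmul[OF lin\<eta>] eta(2))
  have Lhor: "L (hor v) = L v" for v
    unfolding hor_def by (simp add: linear_diff[OF L(1)] linear_cmul[OF L(1)] L\<xi>)
  show "L ` {v. \<eta> v = 0} = UNIV"
    using Lhor \<eta>hor L(2) by (metis (mono_tags, lifting) UNIV_eq_I image_eqI mem_Collect_eq surjD)
  \<comment> \<open>Computing \<open>g (hor v) (\<phi> w)\<close> once by conformality and once by
    the pullback identity shows that the difference is \<open>h\<close>-orthogonal to every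
    \<open>L v\<close>.\<close>
  have "s *\<^sub>R L (\<phi> w) - J (L w) = 0" for w
  proof (rule nondeg)
    fix v
    have "\<eta> (\<phi> w) = 0" using xi eta by simp
    then have "g (hor v) (\<phi> w) = s * h (L v) (L (\<phi> w))"
      using conf[OF \<eta>hor] Lhor by metis
    moreover have "g (hor v) (\<phi> w) = h (L v) (J (L w))"
      using pullback Lhor by metis
    ultimately show "h (L v) (s *\<^sub>R L (\<phi> w) - J (L w)) = 0"
      by (simp add: bilinear_rsub[OF h(1)] bilinear_rmul[OF h(1)])
  qed
  then have JL: "J (L w) = s *\<^sub>R L (\<phi> w)" for w by (metis eq_iff_diff_eq_0)
  \<comment> \<open>Apply \<open>JL\<close> twice; the \<xi> term in the square of \<phi> disappears
    under \<open>L\<close>.\<close>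
  have sL: "L w = (s * s) *\<^sub>R L w" for w
  proof -
    have "- L w = s *\<^sub>R s *\<^sub>R L (\<phi> (\<phi> w))"
      using J(2)[of "L w"] by (simp add: JL linear_cmul[OF J(1)])
    also have "L (\<phi> (\<phi> w)) = - L w"
      unfolding phi by (simp only: linear_add[OF L(1)] linear_neg[OF L(1)] linear_cmul[OF L(1)] L\<xi> scaleR_zero_right add_0_right)
    finally show ?thesis by simp
  qed
  have "s * h (L v) (L w) = h (L v) (L w)"
  proof (cases "L w = 0")
    case True
    then show ?thesis by (simp add: bilinear_rzero[OF h(1)])
  next
    case False
    have "(1 - s * s) *\<^sub>R L w = 0"
      using sL[of w] by (simp add: scaleR_left_diff_distrib)
    with False have "s * s = 1" by simp
    with s have "s = 1" by (metis abs_of_pos abs_square_eq_1 power2_eq_square)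
    then show ?thesis by simp
  qed
  then have "g (hor v) (hor w) = h (L v) (L w)"
    using conf[OF \<eta>hor \<eta>hor] Lhor by metis
  moreover have "g (hor v) (hor w) = g v w - \<eta> v * \<eta> w"
  proof -
    have "g u \<xi> = \<eta> u" for u using g(2) eta(1) by simp
    moreover have "g \<xi> u = \<eta> u" for u using eta(1) by simp
    ultimately show ?thesis
      unfolding hor_def using eta(2)
      by (simp add: linear_diff[OF lin\<eta>] linear_cmul[OF lin\<eta>] bilinear_rsub[OF g(1)] bilinear_rmul[OF g(1)] bilinear_lsub[OF g(1)] bilinear_lmul[OF g(1)])
  qed
  ultimately show "g v w = \<eta> v * \<eta> w + h (L v) (L w)" by simp
qed

section \<open>Conformal Boothby--Wang fibrations\<close>

text \<open>The pointwise splitting, read in charts. Its third conclusion serves both goals: on the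
  kernel of \<eta> it is the isometry property, and differentiated along \<xi> it gives the Killing
  equation.\<close>

lemma boothby_wang_conformal_splitting:
  assumes cm: "contact_metric n M \<eta> \<xi> gM \<phi>"
    and sm: "symplectic_metric B \<omega> gB J"
    and bw: "boothby_wang M \<eta> \<xi> B \<omega> \<pi>"
    and conf: "conformal_submersion M \<eta> gM B gB \<pi>"
    and c: "c \<in> M" and d: "d \<in> B" and p: "p \<in> fst c" "\<pi> p \<in> fst d"
  shows "dmap c d \<pi> p (\<xi> c p) = 0"
    and "dmap c d \<pi> p ` contact_distribution \<eta> c p = UNIV"
    and "gM c p v w = \<eta> c p v * \<eta> c p w + gB d (\<pi> p) (dmap c d \<pi> p v) (dmap c d \<pi> p w)"
    and "linear (dmap c d \<pi> p)"
proof -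
  let ?L = "dmap c d \<pi> p"
  have subm: "submersion M B \<pi>" using conf unfolding conformal_submersion_def by blast
  have chart: "is_chart c" using cm c unfolding contact_metric_def smooth_atlas_def by blast
  have "smooth_on (snd c ` (fst c \<inter> \<pi> -` fst d)) (\<lambda>y. snd d (\<pi> (chart_inv c y)))"
    using subm c d unfolding submersion_def smooth_map_on_def by simp
  then have "(\<lambda>y. snd d (\<pi> (chart_inv c y))) differentiable (at (snd c p))"
    by (rule smooth_on_differentiable) (use p in blast)
  \<comment> \<open>\<open>frechet_derivative\<close> is an arbitrary choice where no derivative
    exists, so linearity rests on differentiability of the chart expression.\<close>
  then show lin: "linear ?L"
    unfolding dmap_def chart_deriv_def
    by (metis frechet_derivative_works has_derivative_linear)
  have surj: "surj ?L" using subm c d p unfolding submersion_def by blast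
  obtain f :: "'a \<Rightarrow> real" where "\<forall>c\<in>M. \<forall>d\<in>B. \<forall>p \<in> fst c \<inter> \<pi> -` fst d.
      \<forall>v \<in> contact_distribution \<eta> c p. \<forall>w \<in> contact_distribution \<eta> c p.
        gM c p v w = exp (2 * f p) * gB d (\<pi> p) (dmap c d \<pi> p v) (dmap c d \<pi> p w)"
    using conf unfolding conformal_submersion_def by blast
  then have f: "gM c p v w = exp (2 * f p) * gB d (\<pi> p) (?L v) (?L w)"
    if "\<eta> c p v = 0" "\<eta> c p w = 0" for v w
    using c d p that by (simp add: contact_distribution_def)
  have "riemannian_metric M gM" using cm unfolding contact_metric_def by blast
  note gM = riemannian_metricD(1-3)[OF this c p(1)]
  have "riemannian_metric B gB" using sm unfolding symplectic_metric_def by blast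
  note gB = riemannian_metricD(1,3)[OF this d p(2)]
  have J: "linear (J d (\<pi> p))" "\<And>a. J d (\<pi> p) (J d (\<pi> p) a) = - a"
    using sm d p unfolding symplectic_metric_def almost_complex_def endo_field_def by blast+
  have deta: "ext_deriv \<eta> c p v w = gM c p v (\<phi> c p w)" for v w
    using cm c p unfolding contact_metric_def by blast
  have "ext_deriv \<eta> c p (\<xi> c p) v = 0" for v
    using cm c p unfolding contact_metric_def reeb_field_def by blast
  then have xi: "gM c p (\<xi> c p) (\<phi> c p v) = 0" for v using deta by metis
  have eta: "\<eta> c p v = gM c p (\<xi> c p) v" "\<eta> c p (\<xi> c p) = 1" for v
    using cm c p unfolding contact_metric_def reeb_field_def by blast+
  have phi: "\<phi> c p (\<phi> c p v) = - v + \<eta> c p v *\<^sub>R \<xi> c p" for v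
    using cm c p unfolding contact_metric_def by blast
  \<comment> \<open>The two metric compatibility conditions meet through the pullback of \<omega>
    being the exterior derivative of \<eta>.\<close>
  have pullback: "gB d (\<pi> p) (?L v) (J d (\<pi> p) (?L w)) = gM c p v (\<phi> c p w)" for v w
  proof -
    have "gB d (\<pi> p) (?L v) (J d (\<pi> p) (?L w)) = \<omega> d (\<pi> p) (?L v) (?L w)"
      using sm d p unfolding symplectic_metric_def by blast
    also have "\<dots> = ext_deriv \<eta> c p v w"
      using bw c d p unfolding boothby_wang_def by blast
    finally show ?thesis by (simp add: deta)
  qed
  note result = conformal_factor_trivial[OF gM gB eta phi xi J lin surj pullback exp_gt_zero f]
  show "?L (\<xi> c p) = 0" by (rule result(1))
  show "?L ` contact_distribution \<eta> c p = UNIV"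
    unfolding contact_distribution_def by (rule result(2))
  show "gM c p v w = \<eta> c p v * \<eta> c p w + gB d (\<pi> p) (?L v) (?L w)" by (rule result(3))
qed

text \<open>The splitting holds on a neighbourhood of \<open>p\<close>, so it can be differentiated
  in the chart \<open>c\<close>; each summand is then treated separately.\<close>

lemma boothby_wang_conformal_lie_deriv:
  assumes cm: "contact_metric n M \<eta> \<xi> gM \<phi>"
    and sm: "symplectic_metric B \<omega> gB J"
    and bw: "boothby_wang M \<eta> \<xi> B \<omega> \<pi>"
    and conf: "conformal_submersion M \<eta> gM B gB \<pi>"
    and c: "c \<in> M" and d: "d \<in> B" and p: "p \<in> fst c" "\<pi> p \<in> fst d"
  shows "lie_deriv \<xi> gM c p v w = 0"
proof -
  note split = boothby_wang_conformal_splitting[OF cm sm bw conf c d]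
  have ch: "is_chart c" using cm c unfolding contact_metric_def smooth_atlas_def by blast
  have ch': "is_chart d" using sm d unfolding symplectic_metric_def smooth_atlas_def by blast
  have smooth: "smooth_map M B \<pi>"
    using conf unfolding conformal_submersion_def submersion_def by blast
  \<comment> \<open>The part of the domain of \<open>c\<close> that \<pi> sends into the domain of
    \<open>d\<close>. Its coordinate image \<open>S\<close> is open, so identities on
    \<open>S\<close> pass to derivatives at \<open>x\<close>.\<close>
  define V where "V = fst c \<inter> \<pi> -` fst d"
  define S where "S = snd c ` V"
  define x where "x = snd c p"
  define P where "P = (\<lambda>y. snd d (\<pi> (chart_inv c y)))"
  define P' where "P' = (\<lambda>y. frechet_derivative P (at y))"
  define X where "X = (\<lambda>y. \<xi> c (chart_inv c y))"
  define X' where "X' = frechet_derivative X (at x)"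
  define E where "E = (\<lambda>y. \<eta> c (chart_inv c y))"
  define E' where "E' = (\<lambda>v. frechet_derivative (\<lambda>y. E y v) (at x))"
  define G where "G = (\<lambda>z. gB d (chart_inv d z))"

  have "continuous_on UNIV \<pi>" using smooth unfolding smooth_map_on_def by blast
  moreover have "open (fst c)" "open (fst d)" using ch ch' unfolding is_chart_def by auto
  ultimately have "open V"
    unfolding V_def by (intro open_Int open_vimage)
  then have S: "open S" "x \<in> S"
    unfolding S_def x_def using open_chart_image[OF ch] p by (auto simp: V_def)
  have in_dom: "snd c (chart_inv c y) = y" "chart_inv c y \<in> fst c" "\<pi> (chart_inv c y) \<in> fst d"
    if "y \<in> S" for y
    using that chart_inv_chart[OF ch] unfolding S_def V_def by auto
  have inv_x: "chart_inv c x = p" unfolding x_def using chart_inv_chart[OF ch p(1)] .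
  have dP: "dmap c d \<pi> (chart_inv c y) = P' y" if "y \<in> S" for y
    unfolding dmap_def chart_deriv_def P'_def P_def using in_dom[OF that] by simp
  have GP: "G (P y) = gB d (\<pi> (chart_inv c y))" if "y \<in> S" for y
    unfolding G_def P_def using in_dom[OF that] chart_inv_chart[OF ch'] by simp

  have smP: "smooth_on S P"
    using smooth c d unfolding smooth_map_on_def S_def V_def P_def by simp
  have P: "(P has_derivative P' y) (at y)" if "y \<in> S" for y
    using smooth_on_differentiable[OF smP that] unfolding P'_def frechet_derivative_works .
  have P2: "(\<lambda>y. P' y v) differentiable (at x)" for v
    unfolding P'_def using smP S(2) by (rule smooth_on_frechet_derivative_differentiable)
  have xU: "x \<in> snd c ` fst c" unfolding x_def using p by blast
  have "smooth_on (snd c ` fst c) X"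
    using cm c unfolding contact_metric_def reeb_field_def vector_field_def X_def by blast
  then have X: "(X has_derivative X') (at x)"
    using smooth_on_differentiable[OF _ xU] unfolding X'_def frechet_derivative_works by blast
  have "smooth_on (snd c ` fst c) (\<lambda>y. E y v)" for v
    using cm c unfolding contact_metric_def contact_form_def one_form_def E_def by blast
  then have E: "((\<lambda>y. E y v) has_derivative E' v) (at x)" for v
    using smooth_on_differentiable[OF _ xU] unfolding E'_def frechet_derivative_works by blast
  have gB: "riemannian_metric B gB" using sm unfolding symplectic_metric_def by blast
  have smG: "smooth_on (snd d ` fst d) (\<lambda>z. G z a b)" for a b
    unfolding G_def using gB d p(2) by (rule riemannian_metricD(4))
  have Px: "P x \<in> snd d ` fst d"
    unfolding P_def inv_x using p by blast
  have G: "(\<lambda>z. G z a b) differentiable (at (P x))" for a b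
    by (rule smooth_on_differentiable[OF smG Px])
  have linE: "linear (E y)" if "y \<in> S" for y
    using cm c in_dom[OF that] unfolding contact_metric_def contact_form_def one_form_def E_def by blast
  have bilG: "bilinear (G (P y))" if "y \<in> S" for y
    unfolding GP[OF that] using gB d in_dom(3)[OF that] by (rule riemannian_metricD(1))
  have vert: "P' y (X y) = 0" if "y \<in> S" for y
    using split(1)[OF in_dom(2,3)[OF that]] dP[OF that] unfolding X_def by simp
  have metric: "gM c (chart_inv c y) v w = E y v * E y w + G (P y) (P' y v) (P' y w)" if "y \<in> S" for y v w
    using split(3)[OF in_dom(2,3)[OF that]] dP[OF that] GP[OF that] unfolding E_def by simp

  \<comment> \<open>Differentiating the constant \<open>\<eta>(\<xi>) = 1\<close> is the first half
    of showing that the Lie derivative of \<eta> along \<xi> vanishes, which \<open>lieE\<close>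
    states in components.\<close>
  have "((\<lambda>y. E y (X y)) has_derivative (\<lambda>h. E' (X x) h + E x (X' h))) (at x)"
    by (rule has_derivative_linear_family[OF S linE E X])
  moreover have "E y (X y) = 1" if "y \<in> S" for y
    using cm c in_dom[OF that] unfolding contact_metric_def reeb_field_def E_def X_def by blast
  then have "((\<lambda>y. E y (X y)) has_derivative (\<lambda>h. 0)) (at x)"
    by (intro has_derivative_transform_within_open[OF has_derivative_const[of 1] S]) simp
  ultimately have "E' (X x) h + E x (X' h) = 0" for h
    by (metis has_derivative_unique)
  \<comment> \<open>This is \<open>d\<eta>(\<xi>, h) = 0\<close>, with the value of \<xi> at
    \<open>p\<close> frozen to a constant coordinate field.\<close>
  moreover have "E' h (X x) = E' (X x) h" for h
  proof -
    have "ext_deriv \<eta> c p (\<xi> c p) h = 0"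
      using cm c p unfolding contact_metric_def reeb_field_def by blast
    then show ?thesis
      unfolding ext_deriv_def chart_deriv_def E'_def E_def X_def by (simp add: inv_x flip: x_def)
  qed
  ultimately have lieE: "E' h (X x) = - E x (X' h)" for h
    by (metis eq_neg_iff_add_eq_0)

  obtain H where H: "((\<lambda>y. G (P y) (P' y v) (P' y w)) has_derivative H) (at x)"
    and lieG: "H (X x) + G (P x) (P' x (X' v)) (P' x w) + G (P x) (P' x v) (P' x (X' w)) = 0"
    using pullback_has_derivative_vertical[OF S P P2 X vert bilG G] by blast
  have "((\<lambda>y. E y v * E y w + G (P y) (P' y v) (P' y w)) has_derivative
      (\<lambda>h. (E x v * E' w h + E' v h * E x w) + H h)) (at x)"
    by (intro has_derivative_add has_derivative_mult E H)
  then have "((\<lambda>y. gM c (chart_inv c y) v w) has_derivative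
      (\<lambda>h. (E x v * E' w h + E' v h * E x w) + H h)) (at x)"
    by (rule has_derivative_transform_within_open[OF _ S]) (simp add: metric)
  then have "chart_deriv c (\<lambda>q. gM c q v w) p = (\<lambda>h. (E x v * E' w h + E' v h * E x w) + H h)"
    unfolding chart_deriv_def x_def by (rule frechet_derivative_at[symmetric])
  moreover have "chart_deriv c (\<xi> c) p = X'"
    unfolding chart_deriv_def X'_def X_def x_def ..
  moreover have "\<xi> c p = X x" unfolding X_def inv_x ..
  moreover note metric[OF S(2), unfolded inv_x]
  \<comment> \<open>The \<eta> terms cancel in pairs by \<open>lieE\<close>; what remains is
    \<open>lieG\<close>.\<close>
  ultimately show ?thesis
    unfolding lie_deriv_def using lieG by (simp add: lieE)
qed

theorem theorem1p1:
  fixes M :: "('a::{t2_space, second_countable_topology}, 'm::euclidean_space) chart set"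
    and \<eta> :: "('a, 'm) covfield" and \<xi> :: "('a, 'm) vfield"
    and gM :: "('a, 'm) bilfield" and \<phi> :: "('a, 'm) endfield"
    and B :: "('b::{t2_space, second_countable_topology}, 'k::euclidean_space) chart set"
    and \<omega> gB :: "('b, 'k) bilfield" and J :: "('b, 'k) endfield"
    and \<pi> :: "'a \<Rightarrow> 'b" and n :: nat
  assumes "closed_manifold M"
    and "contact_metric n M \<eta> \<xi> gM \<phi>"
    and "regular_field M \<xi>"
    and "symplectic_metric B \<omega> gB J"
    and "boothby_wang M \<eta> \<xi> B \<omega> \<pi>"
    and "conformal_submersion M \<eta> gM B gB \<pi>"
  shows "riemannian_submersion M \<eta> gM B gB \<pi> \<and> K_contact n M \<eta> \<xi> gM \<phi>"
proof
  note hyps = assms(2,4,5,6)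
  show "riemannian_submersion M \<eta> gM B gB \<pi>"
    unfolding riemannian_submersion_def
  proof (intro conjI ballI)
    show "submersion M B \<pi>" using assms(6) unfolding conformal_submersion_def by blast
  next
    fix c d p assume "c \<in> M" "d \<in> B" "p \<in> fst c \<inter> \<pi> -` fst d"
    then show "dmap c d \<pi> p ` contact_distribution \<eta> c p = UNIV"
      using boothby_wang_conformal_splitting(2)[OF hyps] by blast
  next
    fix c d p v w assume "c \<in> M" "d \<in> B" "p \<in> fst c \<inter> \<pi> -` fst d"
      "v \<in> contact_distribution \<eta> c p" "w \<in> contact_distribution \<eta> c p"
    then show "gM c p v w = gB d (\<pi> p) (dmap c d \<pi> p v) (dmap c d \<pi> p w)"
      using boothby_wang_conformal_splitting(3)[OF hyps, of c d p v w]
      by (simp add: contact_distribution_def)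
  qed
  show "K_contact n M \<eta> \<xi> gM \<phi>"
    unfolding K_contact_def killing_def
  proof (intro conjI ballI allI)
    fix c p v w assume cp: "c \<in> M" "p \<in> fst c"
    \<comment> \<open>The Killing condition mentions only charts of \<open>M\<close>, while the
      splitting also needs a chart of the base around \<open>\<pi> p\<close>.\<close>
    have "(\<Union>d\<in>B. fst d) = UNIV"
      using assms(4) unfolding symplectic_metric_def smooth_atlas_def by blast
    then obtain d where "d \<in> B" "\<pi> p \<in> fst d" by blast
    then show "lie_deriv \<xi> gM c p v w = 0"
      using boothby_wang_conformal_lie_deriv[OF hyps] cp by blast
  qed (rule assms(2))
qed

end
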